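(* Let $U$ be a universal matrix of size $n\geq 2$ with the rows $U_1,\ldots,U_n$ and let $\varphi(\cdot)$ be a univariate analytic function defined in a nonempty domain in the complex plane. The components of the inverse to the mapping $x+\varphi(Ux)$ (that is, the solution $x=(x_1,\ldots,x_n)$ to the system of equations $f_j=x_j+\varphi(\langle U_j,x\rangle)$, $j=1,\ldots,n$) are finite superpositions of multiplication by a constant, addition, and the function $\varphi(\cdot)$ applied to $f_1,\ldots,f_n$.
   Context: Here $\langle x,y\rangle=x_1y_1+\ldots+x_ny_n$, and a univariate function $\varphi$ acts on vectors componentwise, so for a square matrix $A$ with rows $A_1,\ldots,A_n$ the mapping $x+\varphi(Ax)$ has coordinates $x_j+\varphi(\langle A_j,x\rangle)$. A complex square matrix $A$ of size $n\geq2$ and an analytic function $\varphi\in\mathcal{O}(\Omega)$ in a nonempty domain $\Omega\subset\mathbb{C}$ form a good pair if the Jacobian determinant of $x\mapsto x+\varphi(Ax)$ is identically equal to a nonzero constant on the domain $\{x\in\mathbb{C}^n:\langle A_j,x\rangle\in\Omega,\ j=1,\ldots,n\}$, which is assumed to be nonempty. $A$ is called universal if it forms a good pair with every analytic function, i.e., for any domain $\Omega$ and any $\varphi\in\mathcal{O}(\Omega)$ such that the mapping is well-defined. (Convention: if $A$ has a zero row, the mapping is not defined when $0\notin\Omega$; $A$ is then still called universal if the Jacobian is a nonzero constant for generic analytic $\varphi$. The zero matrix is universal.) The inverse of a mapping $f$ is an analytic mapping $f^{-1}$ with $f\circ f^{-1}=f^{-1}\circ f={\rm Id}$ in a nonempty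 domain in $\mathbb{C}^n$; it is assumed throughout that the superpositions involved are defined in a certain domain in $\mathbb{C}^n$. *)

theory Defs
  imports "HOL-Complex_Analysis.Complex_Analysis"
begin

definition is_domain :: "'a::topological_space set \<Rightarrow> bool" where
  "is_domain S \<longleftrightarrow> open S \<and> connected S \<and> S \<noteq> {}"

text \<open>The mapping x + phi (A x) and the set of points at which it is defined, for phi defined
  on \<open>\<Omega>\<close>. The j-th coordinate of \<^term>\<open>A *v x\<close> is the bilinear (not Hermitian) product of the
  j-th row of \<open>A\<close> with \<open>x\<close>.\<close>

definition shift_map :: "complex^'n^'n \<Rightarrow> (complex \<Rightarrow> complex) \<Rightarrow> complex^'n \<Rightarrow> complex^'n" where
  "shift_map A \<phi> x = (\<chi> j. x $ j + \<phi> ((A *v x) $ j))"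

definition shift_dom :: "complex^'n^'n \<Rightarrow> complex set \<Rightarrow> (complex^'n) set" where
  "shift_dom A \<Omega> = {x. \<forall>j. (A *v x) $ j \<in> \<Omega>}"

text \<open>At a point of complex differentiability the Frechet derivative is complex linear, so
  \<^const>\<open>jacobian\<close> at type \<^typ>\<open>complex^'n^'n\<close> is the matrix of complex partial derivatives.\<close>

definition good_pair :: "complex^'n^'n \<Rightarrow> complex set \<Rightarrow> (complex \<Rightarrow> complex) \<Rightarrow> bool" where
  "good_pair A \<Omega> \<phi> \<longleftrightarrow>
     is_domain \<Omega> \<and> \<phi> holomorphic_on \<Omega> \<and> shift_dom A \<Omega> \<noteq> {} \<and>
     (\<exists>c. c \<noteq> 0 \<and> (\<forall>x \<in> shift_dom A \<Omega>. det (jacobian (shift_map A \<phi>) (at x)) = c))"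

text \<open>Only those \<open>\<Omega>\<close> are considered for which the mapping is defined somewhere. In particular, if
  \<open>A\<close> has a zero row, then domains not containing 0 put no condition on \<open>A\<close>, and the zero matrix
  is universal.\<close>

definition universal :: "complex^'n^'n \<Rightarrow> bool" where
  "universal A \<longleftrightarrow>
     (\<forall>\<Omega> \<phi>. is_domain \<Omega> \<and> \<phi> holomorphic_on \<Omega> \<and> shift_dom A \<Omega> \<noteq> {} \<longrightarrow> good_pair A \<Omega> \<phi>)"

text \<open>Complex differentiability in several variables, the analogue of \<^term>\<open>g holomorphic_on V\<close>;
  used for open \<open>V\<close>.\<close>

definition holomorphic_map_on :: "(complex^'n \<Rightarrow> complex^'m) \<Rightarrow> (complex^'n) set \<Rightarrow> bool" where
  "holomorphic_map_on g V \<longleftrightarrow>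
     (\<forall>y\<in>V. \<exists>L. (g has_derivative L) (at y within V) \<and> (\<forall>c v. L (c *s v) = c *s L v))"

text \<open>\<open>g\<close> is an analytic inverse of \<open>f\<close>, with \<open>f\<close> restricted to the domain \<open>W\<close> and \<open>g\<close> defined on
  the domain \<open>V\<close>.\<close>

definition analytic_inverse ::
  "(complex^'n \<Rightarrow> complex^'n) \<Rightarrow> (complex^'n) set \<Rightarrow>
   (complex^'n \<Rightarrow> complex^'n) \<Rightarrow> (complex^'n) set \<Rightarrow> bool" where
  "analytic_inverse f W g V \<longleftrightarrow>
     is_domain W \<and> is_domain V \<and> holomorphic_map_on g V \<and>
     (\<forall>x\<in>W. f x \<in> V \<and> g (f x) = x) \<and> (\<forall>y\<in>V. g y \<in> W \<and> f (g y) = y)"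

text \<open>Finite superpositions of multiplication by a constant, addition and a univariate function
  phi, applied to variables indexed by \<open>'n\<close>. There are no free additive constants.\<close>

datatype 'n superposition =
    Var 'n
  | Scale complex "'n superposition"
  | Add "'n superposition" "'n superposition"
  | Phi "'n superposition"

primrec sup_eval :: "(complex \<Rightarrow> complex) \<Rightarrow> complex^'n \<Rightarrow> 'n superposition \<Rightarrow> complex" where
  "sup_eval \<phi> f (Var i) = f $ i"
| "sup_eval \<phi> f (Scale c s) = c * sup_eval \<phi> f s"
| "sup_eval \<phi> f (Add s t) = sup_eval \<phi> f s + sup_eval \<phi> f t"
| "sup_eval \<phi> f (Phi s) = \<phi> (sup_eval \<phi> f s)"

text \<open>Since HOL functions are total, it must be recorded that phi is only ever applied to points
  of the set \<open>\<Omega>\<close> on which it is given.\<close>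

primrec sup_defined ::
  "complex set \<Rightarrow> (complex \<Rightarrow> complex) \<Rightarrow> complex^'n \<Rightarrow> 'n superposition \<Rightarrow> bool" where
  "sup_defined \<Omega> \<phi> f (Var i) \<longleftrightarrow> True"
| "sup_defined \<Omega> \<phi> f (Scale c s) \<longleftrightarrow> sup_defined \<Omega> \<phi> f s"
| "sup_defined \<Omega> \<phi> f (Add s t) \<longleftrightarrow> sup_defined \<Omega> \<phi> f s \<and> sup_defined \<Omega> \<phi> f t"
| "sup_defined \<Omega> \<phi> f (Phi s) \<longleftrightarrow> sup_defined \<Omega> \<phi> f s \<and> sup_eval \<phi> f s \<in> \<Omega>"

end

theory Submission
  imports Defs
begin

no_notation fps_nth (infixl "$" 75)

text \<open>Group the indices by equality of rows of \<open>U\<close>, and let \<open>b i k\<close> be the sum of the entries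
  \<open>U\<^sub>i\<^sub>j\<close> over the indices \<open>j\<close> in the class of \<open>k\<close>. The products \<open>y\<^sub>i = \<langle>U\<^sub>i, x\<rangle>\<close> then satisfy
  \<open>\<langle>U\<^sub>i, f\<rangle> = y\<^sub>i + \<Sum> b i k \<phi>(y\<^sub>k)\<close>, summed over classes. If \<open>U\<close> is universal, every nonempty union
  \<open>S\<close> of classes contains some \<open>i\<close> with \<open>b i k = 0\<close> for all \<open>k\<close> in \<open>S\<close>: otherwise a generic vector
  \<open>v\<close> that is constant on classes and supported on \<open>S\<close> has \<open>(U v)\<^sub>i \<noteq> 0\<close> for all \<open>i\<close> in \<open>S\<close>, and an
  entire function with derivative \<open>- v\<^sub>i / (U v)\<^sub>i\<close> or \<open>0\<close> at the points \<open>y\<^sub>i\<close>, for \<open>i\<close> inside or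
  outside \<open>S\<close> and \<open>x\<close> generic, gives a mapping whose Jacobian matrix at \<open>x\<close> annihilates \<open>v\<close>.
  Applied to the set \<open>S\<close> of the \<open>i\<close> for which \<open>y\<^sub>i\<close> is not a superposition in \<open>f\<close>, this shows that
  \<open>S\<close> is empty, and \<open>x\<^sub>i = f\<^sub>i - \<phi>(y\<^sub>i)\<close>.\<close>

section \<open>Generic vectors and entire interpolation\<close>

lemma matrix_vector_mult_axis:
  fixes A :: "'a::semiring_1^'n^'m"
  shows "(A *v axis j 1) $ i = A $ i $ j"
  by (simp add: matrix_vector_mult_def axis_def if_distrib cong: if_cong)

text \<open>Induction: if \<open>u\<close> works for \<open>I\<close>, move from it along a
  \<open>v\<close> on which the new form is nonzero. On the line \<open>u + t *s v\<close> each form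
  that does not vanish at \<open>v\<close> excludes a single \<open>t\<close>, and there are
  infinitely many \<open>t\<close>.\<close>

lemma common_nonzero_point:
  fixes l :: "'i \<Rightarrow> complex^'n \<Rightarrow> complex" and P :: "(complex^'n) set"
  assumes "finite I" "0 \<in> P" and P: "\<And>c u v. u \<in> P \<Longrightarrow> v \<in> P \<Longrightarrow> u + c *s v \<in> P"
    and lin: "\<And>i c u v. l i (u + c *s v) = l i u + c * l i v"
    and "\<And>i. i \<in> I \<Longrightarrow> \<exists>v\<in>P. l i v \<noteq> 0"
  shows "\<exists>v\<in>P. \<forall>i\<in>I. l i v \<noteq> 0"
  using assms(1,5)
proof (induction I)
  case empty
  then show ?case using \<open>0 \<in> P\<close> by auto
next
  case (insert i I)
  have "\<exists>u\<in>P. \<forall>i\<in>I. l i u \<noteq> 0"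
    using insert.prems by (intro insert.IH) simp
  then obtain u where u: "u \<in> P" "\<And>j. j \<in> I \<Longrightarrow> l j u \<noteq> 0"
    by blast
  obtain v where v: "v \<in> P" "l i v \<noteq> 0"
    using insert.prems[of i] by blast
  \<comment> \<open>If \<open>l j v = 0\<close>, the listed quotient is 0 and excludes only
    \<open>t = 0\<close>; such a \<open>j\<close> differs from \<open>i\<close>, and its form keeps
    the nonzero value it has at \<open>u\<close>.\<close>
  obtain t where t: "t \<notin> (\<lambda>j. - l j u / l j v) ` insert i I"
    using ex_new_if_finite[OF infinite_UNIV_char_0, of "(\<lambda>j. - l j u / l j v) ` insert i I"] insert.hyps(1)
    by auto
  have "l j (u + t *s v) \<noteq> 0" if "j \<in> insert i I" for j
  proof (cases "l j v = 0")
    case True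
    then show ?thesis using that u(2) v(2) lin by auto
  next
    case False
    have "t \<noteq> - l j u / l j v" using t that by blast
    then show ?thesis using False by (simp add: lin field_simps add_eq_0_iff)
  qed
  then show ?case using P[OF u(1) v(1)] by blast
qed

text \<open>Newton interpolation: the correction for a new node is a multiple of \<open>w\<close>,
  which vanishes at all old nodes and not at the new one.\<close>

lemma entire_interpolation:
  fixes d :: "complex \<Rightarrow> complex"
  assumes "finite Y"
  shows "\<exists>q. q holomorphic_on UNIV \<and> (\<forall>y\<in>Y. q y = d y)"
  using assms
proof (induction Y)
  case empty
  then show ?case by (auto intro: holomorphic_on_const)
next
  case (insert y Y)
  then obtain q where q: "q holomorphic_on UNIV" "\<And>y. y \<in> Y \<Longrightarrow> q y = d y"
    by blast
  define w where "w = (\<lambda>x. \<Prod>z\<in>Y. x - z)"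
  have "w y \<noteq> 0" "\<And>z. z \<in> Y \<Longrightarrow> w z = 0"
    using insert.hyps by (auto simp: w_def)
  then have "\<forall>z\<in>insert y Y. q z + (d y - q y) / w y * w z = d z"
    using q(2) by auto
  moreover have "(\<lambda>z. q z + (d y - q y) / w y * w z) holomorphic_on UNIV"
    unfolding w_def by (intro holomorphic_intros q(1))
  ultimately show ?case by blast
qed

lemma entire_with_prescribed_derivatives:
  fixes d :: "complex \<Rightarrow> complex"
  assumes "finite Y"
  shows "\<exists>p p'. (\<forall>z. (p has_field_derivative p' z) (at z)) \<and> (\<forall>y\<in>Y. p' y = d y)"
proof -
  obtain q where "q holomorphic_on UNIV" "\<forall>y\<in>Y. q y = d y"
    using entire_interpolation[OF assms] by blast
  moreover from this(1) obtain p where "\<And>z. (p has_field_derivative q z) (at z)"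
    using holomorphic_convex_primitive'[of UNIV q] by auto
  ultimately show ?thesis by blast
qed

section \<open>The Jacobian matrix of the mapping\<close>

lemma has_derivative_vec_iff:
  fixes f :: "'a::real_normed_vector \<Rightarrow> complex^'n"
  shows "(f has_derivative f') (at x within S) \<longleftrightarrow>
    (\<forall>j. ((\<lambda>x. f x $ j) has_derivative (\<lambda>v. f' v $ j)) (at x within S))"
proof (intro iffI allI)
  assume "(f has_derivative f') (at x within S)"
  then show "((\<lambda>x. f x $ j) has_derivative (\<lambda>v. f' v $ j)) (at x within S)" for j
    by (rule bounded_linear.has_derivative[OF bounded_linear_vec_nth])
next
  assume "\<forall>j. ((\<lambda>x. f x $ j) has_derivative (\<lambda>v. f' v $ j)) (at x within S)"
  then show "(f has_derivative f') (at x within S)"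
    by (subst has_derivative_componentwise_within)
      (auto simp: Basis_vec_def inner_axis intro!: has_derivative_inner_left)
qed

lemma matrix_vector_mult_add_scale_nth:
  fixes A :: "'a::comm_semiring_1^'n^'m"
  shows "(A *v (u + c *s v)) $ i = (A *v u) $ i + c * (A *v v) $ i"
  by (simp add: matrix_vector_mult_def sum.distrib sum_distrib_left algebra_simps)

lemma bounded_linear_matrix_vector_nth:
  fixes A :: "complex^'n^'m"
  shows "bounded_linear (\<lambda>x. (A *v x) $ i)"
  unfolding matrix_vector_mult_def
  by (simp add: bounded_linear_sum bounded_linear_const_mult bounded_linear_vec_nth)

text \<open>The action on a vector is recorded instead of the entries, because universality will be
  refuted by exhibiting a kernel vector.\<close>

lemma jacobian_shift_map_mult:
  fixes A :: "complex^'n^'n"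
  assumes "\<And>j. (\<phi> has_field_derivative \<phi>' ((A *v x) $ j)) (at ((A *v x) $ j))"
  shows "jacobian (shift_map A \<phi>) (at x) *v v =
    (\<chi> j. v $ j + \<phi>' ((A *v x) $ j) * (A *v v) $ j)"
proof -
  define L where "L = (\<lambda>v. \<chi> j. v $ j + \<phi>' ((A *v x) $ j) * (A *v v) $ j)"
  have phi: "((\<lambda>x. \<phi> ((A *v x) $ j)) has_derivative (\<lambda>v. \<phi>' ((A *v x) $ j) * (A *v v) $ j)) (at x)" for j
    using has_derivative_compose[OF bounded_linear_imp_has_derivative[OF bounded_linear_matrix_vector_nth[of A j]]
        assms[unfolded has_field_derivative_def]] .
  have "(shift_map A \<phi> has_derivative L) (at x)"
    unfolding has_derivative_vec_iff L_def shift_map_def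
    by (auto intro!: has_derivative_add phi bounded_linear_imp_has_derivative bounded_linear_vec_nth)
  then have "jacobian (shift_map A \<phi>) (at x) = matrix L"
    unfolding jacobian_def using frechet_derivative_at by metis
  moreover have "matrix L *v v = L v"
  proof -
    have "matrix L $ i $ j = (if i = j then 1 else 0) + \<phi>' ((A *v x) $ i) * A $ i $ j" for i j
      by (simp add: matrix_def L_def matrix_vector_mult_axis) (simp add: axis_def)
    moreover have "(\<Sum>j\<in>UNIV. (if i = j then 1 else 0) * v $ j) = v $ i" for i
      by (simp add: if_distrib[of "\<lambda>c. c * _"] cong: if_cong)
    ultimately have "(matrix L *v v) $ i = L v $ i" for i
      by (simp add: matrix_vector_mult_def[of "matrix L"] distrib_right sum.distrib)
        (simp add: L_def matrix_vector_mult_def[of A v] sum_distrib_left mult.assoc)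
    then show ?thesis by (simp add: vec_eq_iff)
  qed
  ultimately show ?thesis by (simp add: L_def)
qed

section \<open>The combinatorial consequence of universality\<close>

lemma good_pair_UNIV_jacobian_injective:
  assumes "good_pair A UNIV \<phi>" and "jacobian (shift_map A \<phi>) (at x) *v v = 0"
  shows "v = 0"
proof -
  have "det (jacobian (shift_map A \<phi>) (at x)) \<noteq> 0"
    using assms(1) unfolding good_pair_def shift_dom_def by auto
  then show ?thesis
    using assms(2) invertible_det_nz[of "jacobian (shift_map A \<phi>) (at x)"]
      matrix_left_invertible_ker[of "jacobian (shift_map A \<phi>) (at x)"] invertible_left_inverse
    by metis
qed

text \<open>Draw an edge from the row class of \<open>i\<close> to that of \<open>k\<close> when the
  displayed sum is nonzero. Every nonempty union \<open>S\<close> of classes has a class with no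
  edge into \<open>S\<close>, so this graph is acyclic, loops included.\<close>

lemma universal_sink:
  fixes U :: "complex^'n^'n"
  assumes "universal U" "S \<noteq> {}"
    and S: "\<And>i k. i \<in> S \<Longrightarrow> U $ i = U $ k \<Longrightarrow> k \<in> S"
  shows "\<exists>i\<in>S. \<forall>k\<in>S. (\<Sum>j | U $ j = U $ k. U $ i $ j) = 0"
proof (rule ccontr)
  assume "\<not> ?thesis"
  then have b: "\<exists>k\<in>S. (\<Sum>j | U $ j = U $ k. U $ i $ j) \<noteq> 0" if "i \<in> S" for i
    using that by blast
  define P :: "(complex^'n) set" where
    "P = {v. (\<forall>i. i \<notin> S \<longrightarrow> v $ i = 0) \<and> (\<forall>i k. U $ i = U $ k \<longrightarrow> v $ i = v $ k)}"
  have P_class: "v $ i = v $ k" if "v \<in> P" "U $ i = U $ k" for v i k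
    using that unfolding P_def by blast
  have P_support: "v $ i = 0" if "v \<in> P" "i \<notin> S" for v i
    using that unfolding P_def by blast
  have P_closed: "u + c *s v \<in> P" if "u \<in> P" "v \<in> P" for c u v
    unfolding P_def mem_Collect_eq
  proof (intro conjI allI impI)
    show "(u + c *s v) $ i = 0" if "i \<notin> S" for i
      using that \<open>u \<in> P\<close> \<open>v \<in> P\<close> by (simp add: P_support)
    show "(u + c *s v) $ i = (u + c *s v) $ k" if "U $ i = U $ k" for i k
      using P_class[OF \<open>u \<in> P\<close> that] P_class[OF \<open>v \<in> P\<close> that] by simp
  qed
  have "\<exists>v\<in>P. \<forall>i\<in>S. (U *v v) $ i \<noteq> 0"
  proof (rule common_nonzero_point)
    show "finite S" "0 \<in> P" by (simp_all add: P_def)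
    show "u + c *s v \<in> P" if "u \<in> P" "v \<in> P" for c u v
      using that by (rule P_closed)
    show "(U *v (u + c *s v)) $ i = (U *v u) $ i + c * (U *v v) $ i" for i c u v
      by (rule matrix_vector_mult_add_scale_nth)
    fix i assume "i \<in> S"
    then obtain k where k: "k \<in> S" "(\<Sum>j | U $ j = U $ k. U $ i $ j) \<noteq> 0"
      using b by blast
    \<comment> \<open>The indicator of the class of \<open>k\<close>; the class lies inside
      \<open>S\<close>, so \<open>v\<close> is in \<open>P\<close>, and its product with row
      \<open>i\<close> is the class sum.\<close>
    define v :: "complex^'n" where "v = (\<chi> j. if U $ j = U $ k then 1 else 0)"
    have "v \<in> P" using S[OF k(1)] by (auto simp: P_def v_def)
    moreover have "(U *v v) $ i = (\<Sum>j | U $ j = U $ k. U $ i $ j)"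
      by (simp add: matrix_vector_mult_def v_def if_distrib sum.If_cases cong: if_cong)
    ultimately show "\<exists>v\<in>P. (U *v v) $ i \<noteq> 0" using k(2) by metis
  qed
  then obtain v where v: "v \<in> P" "\<And>i. i \<in> S \<Longrightarrow> (U *v v) $ i \<noteq> 0" by blast
  \<comment> \<open>The same genericity, applied to differences of distinct rows, gives an
    \<open>x\<close> at which only equal rows have equal products.\<close>
  have "\<exists>x\<in>UNIV. \<forall>(i,k)\<in>{(i,k). U $ i \<noteq> U $ k}. (U *v x) $ i - (U *v x) $ k \<noteq> 0"
    unfolding case_prod_beta
  proof (rule common_nonzero_point)
    fix p :: "'n \<times> 'n" assume "p \<in> {p. U $ fst p \<noteq> U $ snd p}"
    then obtain m where "U $ fst p $ m \<noteq> U $ snd p $ m" by (auto simp: vec_eq_iff)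
    then have "(U *v axis m 1) $ fst p - (U *v axis m 1) $ snd p \<noteq> 0"
      by (simp add: matrix_vector_mult_axis)
    then show "\<exists>x\<in>UNIV. (U *v x) $ fst p - (U *v x) $ snd p \<noteq> 0" by blast
  qed (simp_all only: matrix_vector_mult_add_scale_nth, simp_all add: algebra_simps)
  then obtain x where x: "\<And>i k. (U *v x) $ i = (U *v x) $ k \<Longrightarrow> U $ i = U $ k"
    by auto
  \<comment> \<open>Chosen to solve \<open>v $ i + e i * (U *v v) $ i = 0\<close>; outside
    \<open>S\<close> both \<open>v $ i\<close> and \<open>e i\<close> are 0.\<close>
  define e where "e = (\<lambda>i. if i \<in> S then - v $ i / (U *v v) $ i else 0)"
  \<comment> \<open>Turns \<open>e\<close> into a function of the value of the product. The choice
    of index is harmless: equal values force equal rows, and \<open>e\<close> is constant on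
    classes.\<close>
  define d where "d = (\<lambda>y. e (SOME i. (U *v x) $ i = y))"
  have d: "d ((U *v x) $ i) = e i" for i
  proof -
    define k where "k = (SOME k. (U *v x) $ k = (U *v x) $ i)"
    have "(U *v x) $ k = (U *v x) $ i" unfolding k_def by (rule someI) simp
    then have ki: "U $ k = U $ i" by (rule x)
    then have "k \<in> S \<longleftrightarrow> i \<in> S" using S by metis
    moreover have "v $ k = v $ i" using v(1) ki by (rule P_class)
    moreover have "(U *v v) $ k = (U *v v) $ i" using ki by (simp add: matrix_vector_mult_def)
    ultimately show ?thesis by (simp add: d_def e_def k_def[symmetric])
  qed
  obtain p p' where p: "\<And>z. (p has_field_derivative p' z) (at z)"
    and p': "\<And>i. p' ((U *v x) $ i) = e i"
    using entire_with_prescribed_derivatives[of "range (($) (U *v x))" d] d by auto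
  have "p holomorphic_on UNIV" using p by (auto simp: holomorphic_on_open)
  then have "good_pair U UNIV p"
    using \<open>universal U\<close> by (auto simp: universal_def is_domain_def shift_dom_def)
  moreover have "jacobian (shift_map U p) (at x) *v v = 0"
  proof -
    have "v $ i + e i * (U *v v) $ i = 0" for i
      using v(2) P_support[OF v(1)] by (cases "i \<in> S") (simp_all add: e_def)
    then show ?thesis
      by (simp add: jacobian_shift_map_mult[of p p', OF p] p' vec_eq_iff)
  qed
  ultimately have "v = 0" by (rule good_pair_UNIV_jacobian_injective)
  then show False using v(2) \<open>S \<noteq> {}\<close> by auto
qed

section \<open>Superpositions in the image coordinates\<close>

text \<open>The superposition is evaluated at the image of \<open>x\<close>, but the target is a
  function of \<open>x\<close>; this makes sense before an inverse is constructed, and one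
  \<open>s\<close> serves all points.\<close>

definition represents ::
  "complex^'n^'n \<Rightarrow> complex set \<Rightarrow> (complex \<Rightarrow> complex) \<Rightarrow> 'n superposition \<Rightarrow> (complex^'n \<Rightarrow> complex) \<Rightarrow> bool" where
  "represents A \<Omega> \<phi> s h \<longleftrightarrow> (\<forall>x\<in>shift_dom A \<Omega>.
     sup_defined \<Omega> \<phi> (shift_map A \<phi> x) s \<and> sup_eval \<phi> (shift_map A \<phi> x) s = h x)"

lemma represents_sum:
  fixes A :: "complex^'n^'n"
  assumes "finite J" "\<And>j. j \<in> J \<Longrightarrow> \<exists>s. represents A \<Omega> \<phi> s (h j)"
  shows "\<exists>s. represents A \<Omega> \<phi> s (\<lambda>x. \<Sum>j\<in>J. c j * h j x)"
  using assms
proof (induction J)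
  case empty
  \<comment> \<open>Superpositions have no constants, so the empty sum is written as 0 times an
    arbitrary variable.\<close>
  have "represents A \<Omega> \<phi> (Scale 0 (Var (undefined :: 'n))) (\<lambda>x. 0)"
    by (simp add: represents_def)
  then show ?case by auto
next
  case (insert j J)
  then obtain s t where "represents A \<Omega> \<phi> s (\<lambda>x. \<Sum>j\<in>J. c j * h j x)" "represents A \<Omega> \<phi> t (h j)"
    by (metis insertCI)
  then have "represents A \<Omega> \<phi> (Add (Scale (c j) t) s) (\<lambda>x. \<Sum>j\<in>insert j J. c j * h j x)"
    using insert.hyps by (simp add: represents_def)
  then show ?case by blast
qed

lemma represents_linear_diff:
  assumes "represents A \<Omega> \<phi> s g" "represents A \<Omega> \<phi> t h"
  shows "represents A \<Omega> \<phi> (Add s (Scale (- 1) t)) (\<lambda>x. g x - h x)"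
  using assms by (simp add: represents_def)

lemma represents_Phi:
  assumes "represents A \<Omega> \<phi> s (\<lambda>x. (A *v x) $ i)"
  shows "represents A \<Omega> \<phi> (Phi s) (\<lambda>x. \<phi> ((A *v x) $ i))"
  using assms by (simp add: represents_def shift_dom_def)

lemma represents_Var: "represents A \<Omega> \<phi> (Var i) (\<lambda>x. shift_map A \<phi> x $ i)"
  by (simp add: represents_def)

lemma universal_represents_product:
  fixes U :: "complex^'n^'n"
  assumes "universal U"
  shows "\<exists>s. represents U \<Omega> \<phi> s (\<lambda>x. (U *v x) $ i)"
proof (rule ccontr)
  define S where "S = {i. \<nexists>s. represents U \<Omega> \<phi> s (\<lambda>x. (U *v x) $ i)}"
  assume "\<not> ?thesis"
  then have "S \<noteq> {}" by (auto simp: S_def)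
  have nth: "(U *v x) $ i = (\<Sum>j\<in>UNIV. U $ i $ j * x $ j)" for x i
    by (simp add: matrix_vector_mult_def)
  have closed: "k \<in> S" if "i \<in> S" "U $ i = U $ k" for i k
    using that by (simp add: S_def nth)
  have "\<exists>i\<in>S. \<forall>k\<in>S. (\<Sum>j | U $ j = U $ k. U $ i $ j) = 0"
    using assms \<open>S \<noteq> {}\<close> closed by (rule universal_sink)
  then obtain i where "i \<in> S" and i: "\<And>k. k \<in> S \<Longrightarrow> (\<Sum>j | U $ j = U $ k. U $ i $ j) = 0"
    by (elim bexE) simp
  \<comment> \<open>Group by equal rows: \<open>\<phi>\<close> of the product is constant on a
    class, and its total coefficient is a class sum that vanishes by the choice of
    \<open>i\<close>.\<close>
  have S0: "(\<Sum>j\<in>S. U $ i $ j * \<phi> ((U *v x) $ j)) = 0" for x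
  proof -
    have "(\<Sum>j\<in>S. U $ i $ j * \<phi> ((U *v x) $ j)) =
        (\<Sum>r\<in>($) U ` S. \<Sum>j | j \<in> S \<and> U $ j = r. U $ i $ j * \<phi> ((U *v x) $ j))"
      by (rule sum.image_gen) simp
    also have "\<dots> = 0"
    proof (rule sum.neutral, safe)
      fix k assume k: "k \<in> S"
      have "(\<Sum>j | j \<in> S \<and> U $ j = U $ k. U $ i $ j * \<phi> ((U *v x) $ j)) =
          (\<Sum>j | U $ j = U $ k. U $ i $ j * \<phi> ((U *v x) $ k))"
        \<comment> \<open>\<open>closed\<close> makes the part of the class inside \<open>S\<close>
          the whole class.\<close>
        using closed[OF k] by (intro sum.cong) (auto simp: nth)
      then show "(\<Sum>j | j \<in> S \<and> U $ j = U $ k. U $ i $ j * \<phi> ((U *v x) $ j)) = 0"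
        using i[OF k] by (simp add: sum_distrib_right[symmetric])
    qed
    finally show ?thesis .
  qed
  \<comment> \<open>With the terms from \<open>S\<close> gone, every remaining \<open>\<phi>\<close>
    term has a representable argument, so product \<open>i\<close> is representable, against
    \<open>i \<in> S\<close>.\<close>
  have eq: "(U *v x) $ i = (\<Sum>j\<in>UNIV. U $ i $ j * shift_map U \<phi> x $ j)
      - (\<Sum>j\<in>- S. U $ i $ j * \<phi> ((U *v x) $ j))" for x
  proof -
    have "(\<Sum>j\<in>UNIV. U $ i $ j * shift_map U \<phi> x $ j) =
        (U *v x) $ i + (\<Sum>j\<in>S \<union> - S. U $ i $ j * \<phi> ((U *v x) $ j))"
      by (simp add: shift_map_def nth distrib_left sum.distrib)
    also have "(\<Sum>j\<in>S \<union> - S. U $ i $ j * \<phi> ((U *v x) $ j)) =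
        (\<Sum>j\<in>S. U $ i $ j * \<phi> ((U *v x) $ j)) + (\<Sum>j\<in>- S. U $ i $ j * \<phi> ((U *v x) $ j))"
      by (rule sum.union_disjoint) auto
    finally show ?thesis by (simp add: S0)
  qed
  have "\<exists>s. represents U \<Omega> \<phi> s (\<lambda>x. \<Sum>j\<in>UNIV. U $ i $ j * shift_map U \<phi> x $ j)"
    by (intro represents_sum exI finite) (rule represents_Var)
  then obtain s where s: "represents U \<Omega> \<phi> s (\<lambda>x. \<Sum>j\<in>UNIV. U $ i $ j * shift_map U \<phi> x $ j)" ..
  have "\<exists>t. represents U \<Omega> \<phi> t (\<lambda>x. \<Sum>j\<in>- S. U $ i $ j * \<phi> ((U *v x) $ j))"
  proof (intro represents_sum finite)
    fix j assume "j \<in> - S"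
    then obtain s where "represents U \<Omega> \<phi> s (\<lambda>x. (U *v x) $ j)"
      unfolding S_def by blast
    from represents_Phi[OF this] show "\<exists>t. represents U \<Omega> \<phi> t (\<lambda>x. \<phi> ((U *v x) $ j))" ..
  qed
  then obtain t where t: "represents U \<Omega> \<phi> t (\<lambda>x. \<Sum>j\<in>- S. U $ i $ j * \<phi> ((U *v x) $ j))" ..
  have "(\<lambda>x. (U *v x) $ i) = (\<lambda>x. (\<Sum>j\<in>UNIV. U $ i $ j * shift_map U \<phi> x $ j)
      - (\<Sum>j\<in>- S. U $ i $ j * \<phi> ((U *v x) $ j)))"
    by (rule ext) (rule eq)
  then have "represents U \<Omega> \<phi> (Add s (Scale (- 1) t)) (\<lambda>x. (U *v x) $ i)"
    using represents_linear_diff[OF s t] by (simp only:)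
  then have "i \<notin> S" unfolding S_def by blast
  then show False using \<open>i \<in> S\<close> by contradiction
qed

lemma universal_represents_coordinate:
  fixes U :: "complex^'n^'n"
  assumes "universal U"
  shows "\<exists>s. represents U \<Omega> \<phi> s (\<lambda>x. x $ i)"
proof -
  obtain s where "represents U \<Omega> \<phi> s (\<lambda>x. (U *v x) $ i)"
    using universal_represents_product[OF assms] by blast
  from represents_linear_diff[OF represents_Var represents_Phi[OF this], of i]
  have "represents U \<Omega> \<phi> (Add (Var i) (Scale (- 1) (Phi s))) (\<lambda>x. x $ i)"
    by (simp add: shift_map_def)
  then show ?thesis ..
qed

section \<open>Analyticity and the inverse mapping\<close>

text \<open>Chain rule along \<open>s\<close>: definedness puts each argument of
  \<open>\<phi>\<close> in the open set \<open>\<Omega>\<close>. Homogeneity is carried along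
  because \<open>has_derivative\<close> gives only real linearity.\<close>

lemma sup_eval_has_derivative:
  fixes f :: "complex^'n"
  assumes "open \<Omega>" "\<phi> holomorphic_on \<Omega>" "sup_defined \<Omega> \<phi> f s"
  shows "\<exists>L. ((\<lambda>f. sup_eval \<phi> f s) has_derivative L) (at f) \<and> (\<forall>c v. L (c *s v) = c * L v)"
  using assms(3)
proof (induction s)
  case (Var i)
  have "((\<lambda>f::complex^'n. f $ i) has_derivative (\<lambda>f. f $ i)) (at f)"
    by (rule bounded_linear_imp_has_derivative[OF bounded_linear_vec_nth])
  then show ?case by auto
next
  case (Scale c s)
  then obtain L where "((\<lambda>f. sup_eval \<phi> f s) has_derivative L) (at f)" "\<And>c v. L (c *s v) = c * L v"
    by auto
  then show ?case
    by (auto intro!: exI[of _ "\<lambda>v. c * L v"] has_derivative_mult_right)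
next
  case (Add s t)
  then obtain L M where "((\<lambda>f. sup_eval \<phi> f s) has_derivative L) (at f)" "\<And>c v. L (c *s v) = c * L v"
    "((\<lambda>f. sup_eval \<phi> f t) has_derivative M) (at f)" "\<And>c v. M (c *s v) = c * M v"
    by auto
  then show ?case
    by (auto intro!: exI[of _ "\<lambda>v. L v + M v"] has_derivative_add simp: distrib_left)
next
  case (Phi s)
  then obtain L where L: "((\<lambda>f. sup_eval \<phi> f s) has_derivative L) (at f)" "\<And>c v. L (c *s v) = c * L v"
    by auto
  obtain d where "(\<phi> has_field_derivative d) (at (sup_eval \<phi> f s))"
    using assms(1,2) Phi.prems by (auto simp: holomorphic_on_open)
  from has_derivative_compose[OF L(1) this[unfolded has_field_derivative_def]]
  show ?case using L(2) by (auto intro!: exI[of _ "\<lambda>v. d * L v"])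
qed

lemma open_shift_dom:
  assumes "open \<Omega>"
  shows "open (shift_dom A \<Omega>)"
proof -
  have "shift_dom A \<Omega> = (\<Inter>j. (\<lambda>x. (A *v x) $ j) -` \<Omega>)"
    by (auto simp: shift_dom_def)
  then show ?thesis
    using assms
    by (auto intro!: open_INT open_vimage linear_continuous_on bounded_linear_matrix_vector_nth)
qed

lemma continuous_on_shift_map:
  assumes "continuous_on \<Omega> \<phi>"
  shows "continuous_on (shift_dom A \<Omega>) (shift_map A \<phi>)"
proof -
  have "continuous_on (shift_dom A \<Omega>) (\<lambda>x. \<phi> ((A *v x) $ j))" for j
    by (rule continuous_on_compose2[OF assms linear_continuous_on[OF bounded_linear_matrix_vector_nth]])
      (auto simp: shift_dom_def)
  then show ?thesis
    unfolding shift_map_def by (intro continuous_intros)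
qed

theorem corollary5p6:
  fixes U :: "complex^'n^'n" and \<phi> :: "complex \<Rightarrow> complex" and \<Omega> :: "complex set"
  assumes "CARD('n) \<ge> 2"
    and "universal U"
    and "is_domain \<Omega>"
    and "\<phi> holomorphic_on \<Omega>"
    and "shift_dom U \<Omega> \<noteq> {}"
  shows "(\<exists>W g V. W \<subseteq> shift_dom U \<Omega> \<and> analytic_inverse (shift_map U \<phi>) W g V) \<and>
    (\<exists>s :: 'n \<Rightarrow> 'n superposition.
       (\<forall>W g V. W \<subseteq> shift_dom U \<Omega> \<and> analytic_inverse (shift_map U \<phi>) W g V \<longrightarrow>
          (\<forall>f\<in>V. \<forall>j. sup_defined \<Omega> \<phi> f (s j) \<and> g f $ j = sup_eval \<phi> f (s j))) \<and>
       (\<forall>x\<in>shift_dom U \<Omega>. \<forall>f. (\<forall>j. f $ j = x $ j + \<phi> ((U *v x) $ j)) \<longrightarrow>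
          (\<forall>j. sup_defined \<Omega> \<phi> f (s j) \<and> x $ j = sup_eval \<phi> f (s j))))"
proof -
  have \<Omega>: "open \<Omega>" using assms(3) by (simp add: is_domain_def)
  obtain s where "\<And>j. represents U \<Omega> \<phi> (s j) (\<lambda>x. x $ j)"
    using universal_represents_coordinate[OF assms(2)] by metis
  then have s: "sup_defined \<Omega> \<phi> (shift_map U \<phi> x) (s j)" "sup_eval \<phi> (shift_map U \<phi> x) (s j) = x $ j"
    if "x \<in> shift_dom U \<Omega>" for x j
    using that by (auto simp: represents_def)
  \<comment> \<open>A left inverse on all of \<open>shift_dom U \<Omega>\<close>. It makes the
    mapping injective, so any ball \<open>W\<close> there can be used, and invariance of domain
    makes its image \<open>V\<close> open.\<close>
  define g where "g = (\<lambda>f. \<chi> j. sup_eval \<phi> f (s j))"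
  have g: "g (shift_map U \<phi> x) = x" if "x \<in> shift_dom U \<Omega>" for x
    using s(2)[OF that] by (simp add: g_def vec_eq_iff)
  obtain x r where r: "r > 0" "ball x r \<subseteq> shift_dom U \<Omega>"
    using open_shift_dom[OF \<Omega>] assms(5) by (metis equals0I openE)
  define W where "W = ball x r"
  define V where "V = shift_map U \<phi> ` W"
  have W: "W \<subseteq> shift_dom U \<Omega>" using r by (simp add: W_def)
  have "is_domain W" using r by (simp add: is_domain_def W_def)
  have cont: "continuous_on W (shift_map U \<phi>)"
    using continuous_on_shift_map[OF holomorphic_on_imp_continuous_on[OF assms(4)]] W
    by (rule continuous_on_subset)
  have "inj_on (shift_map U \<phi>) W"
    using W g by (metis inj_on_inverseI subsetD)
  then have "open V"
    unfolding V_def using invariance_of_domain[OF cont] \<open>is_domain W\<close> by (simp add: is_domain_def)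
  then have "is_domain V"
    using \<open>is_domain W\<close> connected_continuous_image[OF cont] by (simp add: is_domain_def V_def)
  have "holomorphic_map_on g V"
    unfolding holomorphic_map_on_def
  proof
    fix f assume "f \<in> V"
    then have "sup_defined \<Omega> \<phi> f (s j)" for j
      using W s(1) by (auto simp: V_def)
    then have "\<forall>j. \<exists>L. ((\<lambda>f. sup_eval \<phi> f (s j)) has_derivative L) (at f) \<and> (\<forall>c v. L (c *s v) = c * L v)"
      using sup_eval_has_derivative[OF \<Omega> assms(4)] by blast
    from choice[OF this] obtain L where L: "\<And>j. ((\<lambda>f. sup_eval \<phi> f (s j)) has_derivative L j) (at f)"
      "\<And>j c v. L j (c *s v) = c * L j v"
      by blast
    have "(g has_derivative (\<lambda>v. \<chi> j. L j v)) (at f within V)"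
      unfolding has_derivative_vec_iff g_def using L(1) by (auto intro: has_derivative_at_withinI)
    then show "\<exists>L. (g has_derivative L) (at f within V) \<and> (\<forall>c v. L (c *s v) = c *s L v)"
      using L(2) by (auto intro!: exI[of _ "\<lambda>v. \<chi> j. L j v"] simp: vec_eq_iff)
  qed
  then have "analytic_inverse (shift_map U \<phi>) W g V"
    using \<open>is_domain W\<close> \<open>is_domain V\<close> W g
    by (auto simp: analytic_inverse_def V_def)
  \<comment> \<open>For an arbitrary inverse \<open>h\<close>, the point \<open>h f\<close> lies in
    \<open>shift_dom U \<Omega>\<close> and maps to \<open>f\<close>, so the same \<open>s\<close>
    recovers it.\<close>
  moreover have "sup_defined \<Omega> \<phi> f (s j) \<and> h f $ j = sup_eval \<phi> f (s j)"
    if "W' \<subseteq> shift_dom U \<Omega>" "analytic_inverse (shift_map U \<phi>) W' h V'" "f \<in> V'" for W' h V' f j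
  proof -
    have "h f \<in> shift_dom U \<Omega>" "shift_map U \<phi> (h f) = f"
      using that by (auto simp: analytic_inverse_def)
    then show ?thesis using s by metis
  qed
  moreover have "sup_defined \<Omega> \<phi> f (s j) \<and> x $ j = sup_eval \<phi> f (s j)"
    if "x \<in> shift_dom U \<Omega>" "\<forall>j. f $ j = x $ j + \<phi> ((U *v x) $ j)" for x f j
  proof -
    have "f = shift_map U \<phi> x" using that(2) by (simp add: shift_map_def vec_eq_iff)
    then show ?thesis using s[OF that(1)] by simp
  qed
  ultimately show ?thesis
    using W by (intro conjI exI[of _ s]) blast+
qed

end
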